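(* Consider a sequence of multiple testing problems indexed by the number of tests $m\to\infty$, with parameters $p=p_m$, $\tau^2=\tau_m^2$, $\sigma^2=\sigma_m^2$, $\delta_0=\delta_{0m}$, $\delta_A=\delta_{Am}$ such that, with $u=\tau^2/\sigma^2$, $f=(1-p)/p$, $\delta=\delta_0/\delta_A$ and $v=uf^2\delta^2$, as $m\to\infty$: $p\to 0$, $u\to\infty$, $v\to\infty$ and $\frac{\log v}{u}\to C\in(0,\infty)$. Assume that for some constant $\beta_p>1$ and all sufficiently large $m$, $$p_m>\frac{(\log m)^{\beta_p}}{m}.$$ Let $\alpha_m\in(0,1)$ be FDR levels such that (i) $\alpha_m\to\alpha_\infty<1$; (ii) with $r_{\alpha_m}=\frac{\alpha_m}{1-\alpha_m}$ and $s_m$ defined by $\frac{\log(f\delta\sqrt u)}{\log(f/r_{\alpha_m})}=1+s_m$, one has $s_m\to0$ and $2s_m\log(f/r_{\alpha_m})-\log\log(f/r_{\alpha_m})\to-\infty$. Let $c_{\mathrm{BH}}$ be the random threshold of the Benjamini–Hochberg procedure at level $\alpha_m$ and $c_{\mathrm{GW}}$ the Genovese–Wasserman threshold at level $\alpha_m$. Then for every $\varepsilon>0$, every constant $\beta_1>0$ and all sufficiently large $m$ (dependent on $\varepsilon$ and $\beta_1$), $$P(|c_{\mathrm{BH}}-c_{\mathrm{GW}}|>\varepsilon)\le m^{-\beta_1}.$$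
   Context: Model. Given a number of tests $m\ge 1$ and parameters $p\in(0,1)$, $\sigma^2>0$ (known), $\tau^2>0$, let $(\nu_i,X_i)$, $i=1,\dots,m$, be i.i.d. with $P(\nu_i=1)=p=1-P(\nu_i=0)$, $X_i\mid\nu_i=0\sim N(0,\sigma^2)$ and $X_i\mid\nu_i=1\sim N(0,\sigma^2+\tau^2)$. $H_{0i}$ is the event $\nu_i=0$, $H_{Ai}$ is $\nu_i=1$. $\delta_0>0$ and $\delta_A>0$ are the losses for type I and type II errors. Let $Z_i=|X_i|/\sigma$ and $1-\hat F_m(y)=\#\{i: Z_i\ge y\}/m$; $\Phi$ is the standard normal cdf. For level $\alpha$ define: $c_{\mathrm{Bon}}$ by $1-\Phi(c_{\mathrm{Bon}})=\frac{\alpha}{2m}$ (Bonferroni threshold); $\tilde c_{\mathrm{BH}}=\inf\left\{y:\frac{2(1-\Phi(y))}{1-\hat F_m(y)}\le\alpha\right\}$ (the ratio being $+\infty$ when $1-\hat F_m(y)=0$, and $\inf\emptyset=+\infty$); $c_{\mathrm{BH}}=\min\{c_{\mathrm{Bon}},\tilde c_{\mathrm{BH}}\}$ (random threshold of the Benjamini–Hochberg procedure, which rejects $H_{0i}$ iff $Z_i\ge c_{\mathrm{BH}}$); $c_{\mathrm{GW}}$ as the solution of $\frac{1-\Phi(c_{\mathrm{GW}})}{(1-p)(1-\Phi(c_{\mathrm{GW}}))+p\left(1-\Phi\left(c_{\mathrm{GW}}/\sqrt{u+1}\right)\right)}=\alpha$. *)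

theory Defs
  imports "HOL-Probability.Probability"
begin

abbreviation Phi :: "real \<Rightarrow> real" where
  "Phi \<equiv> cdf std_normal_distribution"

abbreviation normal_distribution :: "real \<Rightarrow> real \<Rightarrow> real measure" where
  "normal_distribution \<mu> s \<equiv> density lborel (normal_density \<mu> s)"

text \<open>The pairs \<open>(\<nu> i, X i)\<close>, \<open>1 \<le> i \<le> m\<close>, are independent; they are identically distributed because
  the Bernoulli law of \<open>\<nu> i\<close> and the two conditional laws of \<open>X i\<close> do not depend on \<open>i\<close>.
  The parameters \<open>\<sigma>\<close> and \<open>\<tau>\<close> are the positive roots of the variances \<open>\<sigma>\<^sup>2\<close> and \<open>\<tau>\<^sup>2\<close>, and
  \<^const>\<open>normal_density\<close> takes a standard deviation.\<close>

definition two_groups_model ::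
  "'a measure \<Rightarrow> nat \<Rightarrow> real \<Rightarrow> real \<Rightarrow> real \<Rightarrow> (nat \<Rightarrow> 'a \<Rightarrow> nat) \<Rightarrow> (nat \<Rightarrow> 'a \<Rightarrow> real) \<Rightarrow> bool" where
  "two_groups_model M m p \<sigma> \<tau> \<nu> X \<longleftrightarrow>
     prob_space M \<and>
     prob_space.indep_vars M (\<lambda>_. count_space UNIV \<Otimes>\<^sub>M borel) (\<lambda>i \<omega>. (\<nu> i \<omega>, X i \<omega>)) {1..m} \<and>
     (\<forall>i\<in>{1..m}.
        \<P>(\<omega> in M. \<nu> i \<omega> = 1) = p \<and>
        \<P>(\<omega> in M. \<nu> i \<omega> = 0) = 1 - p \<and>
        (\<forall>B\<in>sets borel.
           \<P>(\<omega> in M. X i \<omega> \<in> B \<bar> \<nu> i \<omega> = 0) = measure (normal_distribution 0 \<sigma>) B \<and>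
           \<P>(\<omega> in M. X i \<omega> \<in> B \<bar> \<nu> i \<omega> = 1)
             = measure (normal_distribution 0 (sqrt (\<sigma>\<^sup>2 + \<tau>\<^sup>2))) B))"

definition c_Bon :: "real \<Rightarrow> nat \<Rightarrow> real" where
  "c_Bon \<alpha> m = (THE c. 1 - Phi c = \<alpha> / (2 * real m))"

text \<open>\<open>emp_tail m z y\<close> is $1 - \hat F_m(y)$ for the realised statistics \<open>z 1, \<dots>, z m\<close>.\<close>

definition emp_tail :: "nat \<Rightarrow> (nat \<Rightarrow> real) \<Rightarrow> real \<Rightarrow> real" where
  "emp_tail m z y = real (card {i \<in> {1..m}. z i \<ge> y}) / real m"

definition BH_ratio :: "nat \<Rightarrow> (nat \<Rightarrow> real) \<Rightarrow> real \<Rightarrow> ereal" where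
  "BH_ratio m z y =
     (if emp_tail m z y = 0 then \<infinity> else ereal (2 * (1 - Phi y) / emp_tail m z y))"

definition c_BH_tilde :: "real \<Rightarrow> nat \<Rightarrow> (nat \<Rightarrow> real) \<Rightarrow> ereal" where
  "c_BH_tilde \<alpha> m z = Inf (ereal ` {y. BH_ratio m z y \<le> ereal \<alpha>})"

definition c_BH :: "real \<Rightarrow> nat \<Rightarrow> (nat \<Rightarrow> real) \<Rightarrow> ereal" where
  "c_BH \<alpha> m z = min (ereal (c_Bon \<alpha> m)) (c_BH_tilde \<alpha> m z)"

text \<open>For \<open>0 < \<alpha> < 1\<close>, \<open>0 < p < 1\<close> and \<open>u > 0\<close> the defining equation has exactly one real solution:
  the left-hand side is at least 1 for \<open>c \<le> 0\<close> and strictly decreases from 1 to 0 on \<open>[0, \<infinity>)\<close>.\<close>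

definition c_GW :: "real \<Rightarrow> real \<Rightarrow> real \<Rightarrow> real" where
  "c_GW \<alpha> p u =
     (THE c. (1 - Phi c) / ((1 - p) * (1 - Phi c) + p * (1 - Phi (c / sqrt (u + 1)))) = \<alpha>)"

end

theory Submission
  imports Defs "HOL-Real_Asymp.Real_Asymp"
begin

text \<open>
  Write \<open>Q = 1 - \<Phi>\<close>, let \<open>T\<close> be the common tail \<open>T(y) = P(Z\<^sub>i \<ge> y)\<close> and \<open>N(y)\<close> the number of
  \<open>i\<close> with \<open>Z\<^sub>i \<ge> y\<close>, a binomial variable with mean \<open>m T(y)\<close>. The threshold \<open>c = c_GW\<close> solves
  \<open>2 Q(c) / T(c) = \<alpha>\<close>, while the Benjamini--Hochberg threshold is, up to the cap \<open>c_Bon\<close>, the infimum of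
  the points where the ratio with \<open>N / m\<close> in place of \<open>T\<close> is at most \<open>\<alpha>\<close>. The proof shows that this
  replacement is harmless at distance \<open>\<epsilon>\<close> from \<open>c\<close>.

  The equation for \<open>c\<close> is equivalent to \<open>Q(c) = \<rho> Q(c / sqrt (u + 1))\<close> with
  \<open>\<rho> = \<alpha> p / (1 - \<alpha> + \<alpha> p)\<close>. Its unique root (lemma \<open>GW_root\<close>) satisfies
  \<open>c\<^sup>2 u / (u + 1) \<le> 2 ln (sqrt (u + 1) / \<rho>)\<close>. Since \<open>1 / \<rho>\<close> is at most a multiple of \<open>f / r\<close>
  and \<open>ln (f / r) = ln v / (2 (1 + s)) = O(u)\<close>, the ratio \<open>c / sqrt (u + 1)\<close> stays bounded
  (lemma \<open>c_GW_le_signal_scale\<close>): a fixed positive proportion of the signals exceeds \<open>c + \<epsilon>\<close>, and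
  \<open>T(c + \<epsilon>)\<close> is of the exact order \<open>p\<close>. On the other hand \<open>Q(c) \<le> \<rho> \<longrightarrow> 0\<close>, so
  \<open>c\<close> tends to infinity and a shift by \<open>\<epsilon>\<close> changes \<open>Q\<close> by a factor at least \<open>exp (\<epsilon> (c - \<epsilon>))\<close>,
  which is unbounded (lemma \<open>normal_tail_shift\<close>).

  Consequently \<open>2 Q(c + \<epsilon>) / \<alpha> \<le> T(c + \<epsilon>) / 2\<close>, so \<open>c_BH > c + \<epsilon>\<close> forces \<open>N(c + \<epsilon>)\<close> to be at most
  half of its mean. To the left of \<open>c - \<epsilon>\<close> the signals are negligible, \<open>T(y) \<le> \<theta> (2 Q(y) / \<alpha>)\<close> with
  \<open>\<theta> < 1\<close> because \<open>\<alpha>\<close> stays away from \<open>1\<close>; and \<open>c_BH < c - \<epsilon>\<close> forces \<open>N(t) \<ge> m (2 Q(t) / \<alpha>)\<close>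
  at one of at most \<open>m\<close> deterministic points \<open>t < c - \<epsilon>\<close> (lemma \<open>c_BH_less_imp\<close>); the cap is
  irrelevant there because \<open>m p \<longrightarrow> \<infinity>\<close> puts \<open>c_Bon\<close> to the right of \<open>c\<close>. Multiplicative
  Chernoff bounds make each of these events have probability at most \<open>exp (- a m p)\<close> for a constant
  \<open>a > 0\<close> (lemma \<open>BH_deviation_bound\<close>), and \<open>(1 + m) exp (- a (ln m)\<^sup>\<beta>)\<close> with \<open>\<beta> > 1\<close> is
  eventually below every power of \<open>m\<close>.
\<close>

section \<open>The standard normal tail\<close>

text \<open>The upper tail of the standard normal law.\<close>

definition normal_tail :: "real \<Rightarrow> real" where
  "normal_tail y = 1 - Phi y"

interpretation std_normal: real_distribution std_normal_distribution
  by (rule real_dist_normal_dist)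

lemma Phi_has_derivative: "(Phi has_real_derivative std_normal_density x) (at x)"
proof -
  have cont: "continuous_on A std_normal_density" for A
    unfolding std_normal_density_def by (intro continuous_intros) auto
  have eq: "Phi y = Phi (x - 1) + integral {x - 1..y} std_normal_density" if "y \<in> {x - 1..x + 1}" for y
  proof (cases "x - 1 = y")
    case False
    with that have "Phi y - Phi (x - 1) = measure std_normal_distribution {x - 1<..y}"
      by (intro std_normal.cdf_diff_eq) auto
    also have "\<dots> = (LINT t:{x - 1<..y}|lborel. std_normal_density t)"
      by (simp add: measure_def emeasure_density set_lebesgue_integral_def integral_eq_nn_integral
          ennreal_mult' ennreal_indicator mult.commute)
    also have "\<dots> = (LINT t:{x - 1..y}|lborel. std_normal_density t)"
      unfolding set_lebesgue_integral_def
      using AE_lborel_singleton[of "x - 1"]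
      by (intro integral_cong_AE) (auto elim!: eventually_mono split: split_indicator)
    also have "\<dots> = integral {x - 1..y} std_normal_density"
      by (intro set_borel_integral_eq_integral borel_integrable_atLeastAtMost'  cont)
    finally show ?thesis by simp
  qed auto
  have "((\<lambda>y. Phi (x - 1) + integral {x - 1..y} std_normal_density) has_real_derivative
      0 + std_normal_density x) (at x within {x - 1..x + 1})"
    by (intro DERIV_add DERIV_const integral_has_real_derivative cont) auto
  then have "((\<lambda>y. Phi (x - 1) + integral {x - 1..y} std_normal_density) has_real_derivative
      std_normal_density x) (at x within {x - 1..x + 1})"
    by (simp only: add_0)
  then have "(Phi has_real_derivative std_normal_density x) (at x within {x - 1..x + 1})"
  proof (rule has_field_derivative_transform_within[OF _ zero_less_one])
    show "Phi (x - 1) + integral {x - 1..y} std_normal_density = Phi y" if "y \<in> {x - 1..x + 1}" for y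
      using eq[OF that] by (rule sym)
  qed simp
  then show ?thesis
    by (simp add: at_within_Icc_at)
qed

lemma normal_tail_has_derivative [derivative_intros]:
  "(normal_tail has_real_derivative - std_normal_density x) (at x)"
  unfolding normal_tail_def
  by (auto intro!: derivative_eq_intros Phi_has_derivative)

lemma normal_tail_strict_antimono: "x < y \<Longrightarrow> normal_tail y < normal_tail x"
  by (rule DERIV_neg_imp_decreasing) (auto intro!: normal_tail_has_derivative simp: normal_density_pos)

lemma normal_tail_less_iff [simp]: "normal_tail x < normal_tail y \<longleftrightarrow> y < x"
  by (metis normal_tail_strict_antimono linorder_neqE_linordered_idom order_less_asym)

lemma normal_tail_le_iff [simp]: "normal_tail x \<le> normal_tail y \<longleftrightarrow> y \<le> x"
  by (meson normal_tail_less_iff linorder_not_less)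

lemma normal_tail_eq_iff [simp]: "normal_tail x = normal_tail y \<longleftrightarrow> x = y"
  by (metis normal_tail_le_iff order_antisym order_refl)

lemma normal_tail_tendsto_0: "(normal_tail \<longlongrightarrow> 0) at_top"
  unfolding normal_tail_def using tendsto_diff[OF tendsto_const std_normal.cdf_lim_at_top_prob, of 1]
  by simp

lemma normal_tail_pos [simp]: "0 < normal_tail x"
proof (rule DERIV_neg_imp_decreasing_at_top[OF _ normal_tail_tendsto_0])
  show "\<exists>y. (normal_tail has_real_derivative y) (at z) \<and> y < 0" for z
    using normal_tail_has_derivative[of z] normal_density_pos[of 1 0 z] by (intro exI conjI) auto
qed

lemma normal_tail_continuous: "continuous_on A normal_tail"
  by (meson DERIV_isCont continuous_at_imp_continuous_on normal_tail_has_derivative)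

text \<open>The scale \<open>s\<close> may be negative; \<open>s = -1\<close> yields the symmetry of the standard normal law.\<close>

lemma measure_normal_scale:
  assumes s: "s \<noteq> 0" and B: "B \<in> sets borel"
  shows "measure (normal_distribution 0 s) B = measure std_normal_distribution {x. s * x \<in> B}"
proof -
  have [measurable]: "(\<lambda>x. s * x) -` B \<in> sets borel"
    using measurable_sets[of "(\<lambda>x. s * x)" borel borel B] B by simp
  have dens: "ennreal \<bar>s\<bar> * ennreal (normal_density 0 s (s * x)) = ennreal (std_normal_density x)" for x
    using s by (simp add: normal_density_def real_sqrt_mult power_mult_distrib ennreal_mult'[symmetric])
  have [measurable]: "B \<in> sets borel" by (fact B)
  have "emeasure (normal_distribution 0 s) B
      = (\<integral>\<^sup>+x. ennreal (normal_density 0 s x) * indicator B x \<partial>lborel)"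
    by (simp add: emeasure_density)
  also have "\<dots> = ennreal \<bar>s\<bar> * (\<integral>\<^sup>+x. ennreal (normal_density 0 s (s * x)) * indicator B (s * x) \<partial>lborel)"
    by (subst nn_integral_real_affine[of _ s 0]) (use s in auto)
  also have "\<dots> = (\<integral>\<^sup>+x. ennreal (std_normal_density x) * indicator ((\<lambda>x. s * x) -` B) x \<partial>lborel)"
    by (subst nn_integral_cmult[symmetric])
       (auto simp: dens mult.assoc[symmetric] indicator_def intro!: nn_integral_cong)
  also have "\<dots> = emeasure std_normal_distribution ((\<lambda>x. s * x) -` B)"
    by (simp add: emeasure_density)
  finally show ?thesis by (simp add: measure_def vimage_def)
qed

lemma measure_std_normal_atLeast: "measure std_normal_distribution {y..} = normal_tail y"
proof -
  have "isCont Phi y" by (rule DERIV_isCont[OF Phi_has_derivative])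
  then have "measure std_normal_distribution {y} = 0"
    by (simp add: std_normal.isCont_cdf)
  moreover have "measure std_normal_distribution ({y} \<union> {y<..})
      = measure std_normal_distribution {y} + measure std_normal_distribution {y<..}"
    by (intro std_normal.finite_measure_Union) auto
  moreover have "{y} \<union> {y<..} = {y..}" by auto
  moreover have "measure std_normal_distribution (UNIV - {..y}) = 1 - Phi y"
    using std_normal.prob_compl[of "{..y}"] by (simp add: cdf_def)
  moreover have "UNIV - {..y} = {y<..}" by auto
  ultimately show ?thesis by (simp add: normal_tail_def)
qed

lemma Phi_uminus: "Phi (- y) = normal_tail y"
proof -
  have "normal_density 0 (- 1) = std_normal_density"
    by (auto simp: normal_density_def fun_eq_iff)
  then have "measure std_normal_distribution {..- y} = measure std_normal_distribution {x. - x \<le> - y}"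
    using measure_normal_scale[of "-1" "{..- y}"] by simp
  also have "{x. - x \<le> - y} = {y..}" by auto
  finally show ?thesis by (simp add: cdf_def measure_std_normal_atLeast)
qed

lemma normal_tail_zero: "normal_tail 0 = 1 / 2"
  using Phi_uminus[of 0] by (simp add: normal_tail_def)

text \<open>The two-sided tail of a centred normal law, in units \<open>s0\<close> other than its own scale.\<close>

lemma measure_normal_two_sided:
  assumes s: "s > 0" and s0: "s0 > 0" and y: "y > 0"
  shows "measure (normal_distribution 0 s) {x. \<bar>x\<bar> / s0 \<ge> y} = 2 * normal_tail (y * s0 / s)"
proof -
  let ?z = "y * s0 / s"
  have z: "?z > 0" using assms by simp
  have "{x. \<bar>x\<bar> / s0 \<ge> y} \<in> sets borel" by measurable
  then have "measure (normal_distribution 0 s) {x. \<bar>x\<bar> / s0 \<ge> y}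
      = measure std_normal_distribution {x. \<bar>s * x\<bar> / s0 \<ge> y}"
    using measure_normal_scale[of s "{x. \<bar>x\<bar> / s0 \<ge> y}"] s by simp
  also have "{x. \<bar>s * x\<bar> / s0 \<ge> y} = {..- ?z} \<union> {?z..}"
    using assms by (auto simp: field_simps abs_mult abs_if)
  also have "measure std_normal_distribution \<dots>
      = measure std_normal_distribution {..- ?z} + measure std_normal_distribution {?z..}"
    using z by (intro std_normal.finite_measure_Union) (auto simp del: divide_pos_pos)
  also have "\<dots> = 2 * normal_tail ?z"
    using Phi_uminus[of ?z] by (simp add: measure_std_normal_atLeast cdf_def)
  finally show ?thesis .
qed

lemma normal_tail_surj:
  assumes "0 < q" "q < 1"
  shows "\<exists>y. normal_tail y = q"
proof -
  have "((\<lambda>y. Phi y) \<longlongrightarrow> 0) at_bot" by (rule std_normal.cdf_lim_at_bot)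
  then have "eventually (\<lambda>y. Phi y < 1 - q) at_bot" using assms by (intro order_tendstoD) auto
  then obtain a where a: "Phi a < 1 - q" by (auto dest: eventually_happens)
  have "eventually (\<lambda>y. normal_tail y < q) at_top"
    using normal_tail_tendsto_0 assms by (intro order_tendstoD) auto
  then obtain b where b: "normal_tail b < q" by (auto dest: eventually_happens)
  have "normal_tail b < normal_tail a" using a b by (simp add: normal_tail_def)
  then have "a \<le> b" by simp
  then show ?thesis
    using IVT2'[of normal_tail b q a] a b normal_tail_continuous by (auto simp: normal_tail_def)
qed

text \<open>The difference of the two sides is monotone to the right of \<open>x\<close>, by comparison of the
  densities, and vanishes at infinity.\<close>

lemma normal_tail_shift:
  assumes "0 \<le> x" "0 \<le> e"
  shows "normal_tail (x + e) \<le> exp (- (x * e)) * normal_tail x"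
proof -
  let ?E = "\<lambda>t. normal_tail (t + e) - exp (- (x * e)) * normal_tail t"
  have der: "(?E has_real_derivative
      - std_normal_density (t + e) + exp (- (x * e)) * std_normal_density t) (at t)" for t
    by (auto intro!: derivative_eq_intros DERIV_chain2[OF normal_tail_has_derivative])
  have nonneg: "- std_normal_density (t + e) + exp (- (x * e)) * std_normal_density t \<ge> 0"
    if "x \<le> t" for t
  proof -
    have "- (t + e)\<^sup>2 / 2 \<le> - (x * e) + - t\<^sup>2 / 2"
    proof -
      have "(t + e)\<^sup>2 = t\<^sup>2 + 2 * (t * e) + e\<^sup>2" by (simp add: power2_sum)
      then show ?thesis
        using mult_right_mono[OF that assms(2)] zero_le_power2[of e] by linarith
    qed
    then have "exp (- (t + e)\<^sup>2 / 2) \<le> exp (- (x * e)) * exp (- t\<^sup>2 / 2)"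
      by (simp only: exp_add[symmetric] exp_le_cancel_iff)
    then show ?thesis
      unfolding std_normal_density_def by (simp add: divide_right_mono)
  qed
  have mono: "?E x \<le> ?E t" if "x \<le> t" for t
    by (rule DERIV_nonneg_imp_nondecreasing[OF that]) (use der nonneg in blast)
  have "(?E \<longlongrightarrow> 0 - exp (- (x * e)) * 0) at_top"
  proof (intro tendsto_intros normal_tail_tendsto_0)
    have "filterlim (\<lambda>t::real. t + e) at_top at_top" by real_asymp
    then show "((\<lambda>t. normal_tail (t + e)) \<longlongrightarrow> 0) at_top"
      by (rule filterlim_compose[OF normal_tail_tendsto_0])
  qed
  then have lim: "(?E \<longlongrightarrow> 0) at_top" by simp
  have "?E x \<le> 0"
    by (rule tendsto_lowerbound[OF lim])
       (auto intro: eventually_mono[OF eventually_ge_at_top[of x] mono])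
  then show ?thesis by simp
qed

section \<open>The Genovese--Wasserman threshold\<close>

text \<open>The difference \<open>D(t) = Q(t) - \<rho> Q(t / k)\<close>, with \<open>Q\<close> the normal tail, is positive at \<open>0\<close> and on
  \<open>[0, \<infinity>)\<close> its derivative changes sign exactly once, from negative to positive, at a point \<open>b\<close> with
  \<open>b\<^sup>2 (1 - 1 / k\<^sup>2) = 2 ln (k / \<rho>)\<close>. As \<open>D\<close> vanishes at infinity, it is negative on \<open>[b, \<infinity>)\<close>
  and has exactly one zero in \<open>[0, b]\<close>; negative arguments are excluded by \<open>\<rho> < 1\<close>.\<close>

lemma GW_root:
  fixes \<rho> k :: real
  assumes \<rho>: "0 < \<rho>" "\<rho> < 1" and k: "k > 1"
  obtains c where "0 < c" "normal_tail c = \<rho> * normal_tail (c / k)"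
    "c\<^sup>2 * (1 - 1 / k\<^sup>2) \<le> 2 * ln (k / \<rho>)"
    "\<And>c'. normal_tail c' = \<rho> * normal_tail (c' / k) \<Longrightarrow> c' = c"
proof -
  define \<kappa> where "\<kappa> = 1 - 1 / k\<^sup>2"
  define b where "b = sqrt (2 * ln (k / \<rho>) / \<kappa>)"
  define D where "D = (\<lambda>t. normal_tail t - \<rho> * normal_tail (t / k))"
  define D' where "D' = (\<lambda>t. std_normal_density t * (\<rho> / k * exp (\<kappa> * t\<^sup>2 / 2) - 1))"
  have "1 < k\<^sup>2" using k by (intro one_less_power) auto
  then have "1 / k\<^sup>2 < 1" by (subst divide_less_eq_1_pos) linarith+
  then have \<kappa>: "\<kappa> > 0" by (simp add: \<kappa>_def)
  have k\<rho>: "k / \<rho> > 1" using k \<rho> by (simp only: less_divide_eq_1_pos)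
  have b2: "b\<^sup>2 * \<kappa> = 2 * ln (k / \<rho>)" and b0: "b > 0"
  proof -
    have q: "2 * ln (k / \<rho>) / \<kappa> > 0"
      using ln_gt_zero[OF k\<rho>] \<kappa> by (intro divide_pos_pos mult_pos_pos) auto
    then show "b > 0" by (simp only: b_def real_sqrt_gt_zero)
    have "b\<^sup>2 = 2 * ln (k / \<rho>) / \<kappa>"
      unfolding b_def using q by (intro real_sqrt_pow2 less_imp_le)
    then show "b\<^sup>2 * \<kappa> = 2 * ln (k / \<rho>)"
      using \<kappa> by (metis nonzero_eq_divide_eq less_irrefl)
  qed
  have scale: "std_normal_density (t / k) = std_normal_density t * exp (\<kappa> * t\<^sup>2 / 2)" for t
  proof -
    have "- (t / k)\<^sup>2 / 2 = - t\<^sup>2 / 2 + \<kappa> * t\<^sup>2 / 2"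
      by (simp add: \<kappa>_def power_divide left_diff_distrib diff_divide_distrib)
    then show ?thesis
      by (simp only: std_normal_density_def exp_add mult.assoc)
  qed
  have der: "(D has_real_derivative D' t) (at t)" for t
    unfolding D_def using k
    by (auto intro!: derivative_eq_intros DERIV_chain2[OF normal_tail_has_derivative]
        simp: D'_def scale field_simps)
  have neg: "D' t < 0" if "0 \<le> t" "t < b" for t
  proof -
    have "t\<^sup>2 * \<kappa> < b\<^sup>2 * \<kappa>" using that \<kappa> by (intro mult_strict_right_mono power_strict_mono) auto
    then have "\<kappa> * t\<^sup>2 / 2 < ln (k / \<rho>)" using b2 by (simp add: mult.commute)
    then have "exp (\<kappa> * t\<^sup>2 / 2) < k / \<rho>" using k\<rho> by (metis exp_less_mono exp_ln order.strict_trans zero_less_one)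
    then have "\<rho> / k * exp (\<kappa> * t\<^sup>2 / 2) < 1" using \<rho> k by (simp add: field_simps)
    then show ?thesis by (simp add: D'_def mult_pos_neg normal_density_pos)
  qed
  have pos: "D' t > 0" if "b < t" for t
  proof -
    have "b\<^sup>2 * \<kappa> < t\<^sup>2 * \<kappa>" using that \<kappa> b0 by (intro mult_strict_right_mono power_strict_mono) auto
    then have "\<kappa> * t\<^sup>2 / 2 > ln (k / \<rho>)" using b2 by (simp add: mult.commute)
    then have "exp (\<kappa> * t\<^sup>2 / 2) > k / \<rho>" using k\<rho> by (metis exp_less_mono exp_ln order.strict_trans zero_less_one)
    then have "\<rho> / k * exp (\<kappa> * t\<^sup>2 / 2) > 1" using \<rho> k by (simp add: field_simps)
    then show ?thesis by (simp add: D'_def normal_density_pos)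
  qed
  have cont: "continuous_on A D" for A
    by (meson DERIV_isCont continuous_at_imp_continuous_on der)
  have lim: "(D \<longlongrightarrow> 0) at_top"
  proof -
    have "filterlim (\<lambda>t. t / k) at_top at_top"
      using k by real_asymp
    then have "(D \<longlongrightarrow> 0 - \<rho> * 0) at_top"
      unfolding D_def
      by (intro tendsto_intros normal_tail_tendsto_0 filterlim_compose[OF normal_tail_tendsto_0])
    then show ?thesis by simp
  qed
  have D_neg': "D t < 0" if "b < t" for t
  proof -
    have "0 < - D t"
    proof (rule DERIV_neg_imp_decreasing_at_top[where f = "\<lambda>t. - D t"])
      show "((\<lambda>t. - D t) \<longlongrightarrow> 0) at_top" using tendsto_minus[OF lim] by simp
      fix x assume "t \<le> x"
      then show "\<exists>y. ((\<lambda>t. - D t) has_real_derivative y) (at x) \<and> y < 0"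
        using pos[of x] that by (intro exI[of _ "- D' x"] conjI DERIV_minus der) auto
    qed
    then show ?thesis by simp
  qed
  have "D b < D (b + 1)"
  proof (rule DERIV_pos_imp_increasing_open[OF _ _ cont])
    fix t assume "b < t"
    then show "\<exists>d. (D has_real_derivative d) (at t) \<and> d > 0"
      by (intro exI[of _ "D' t"] conjI der pos)
  qed simp
  also have "D (b + 1) < 0" by (rule D_neg') simp
  finally have D_neg: "D t < 0" if "b \<le> t" for t
    using that D_neg'[of t] by (cases "t = b") auto
  have decr: "D y < D x" if "0 \<le> x" "x < y" "y \<le> b" for x y
  proof (rule DERIV_neg_imp_decreasing_open[OF \<open>x < y\<close> _ cont])
    fix t assume "x < t" "t < y"
    then show "\<exists>d. (D has_real_derivative d) (at t) \<and> d < 0"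
      using that by (intro exI[of _ "D' t"] conjI der neg) auto
  qed
  have "D 0 > 0" using \<rho> by (simp add: D_def normal_tail_zero)
  then obtain c where c: "0 \<le> c" "c \<le> b" "D c = 0"
    using IVT2'[of D b 0 0] D_neg[of b] b0 cont by auto
  have "c \<noteq> 0" using c \<open>D 0 > 0\<close> by auto
  show thesis
  proof (rule that[of c])
    show "0 < c" using c \<open>c \<noteq> 0\<close> by simp
    show "normal_tail c = \<rho> * normal_tail (c / k)" using c by (simp add: D_def)
    have "c\<^sup>2 * \<kappa> \<le> b\<^sup>2 * \<kappa>" using c \<kappa> by (intro mult_right_mono power_mono) auto
    then show "c\<^sup>2 * (1 - 1 / k\<^sup>2) \<le> 2 * ln (k / \<rho>)" using b2 by (simp add: \<kappa>_def)
    fix c' assume "normal_tail c' = \<rho> * normal_tail (c' / k)"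
    then have c': "D c' = 0" by (simp add: D_def)
    have "0 \<le> c'"
    proof (rule ccontr)
      assume "\<not> 0 \<le> c'"
      then have "c' \<le> c' / k" using k by (simp add: field_simps)
      then have "normal_tail (c' / k) \<le> normal_tail c'" by simp
      moreover have "\<rho> * normal_tail (c' / k) < 1 * normal_tail (c' / k)"
        using \<rho> by (intro mult_strict_right_mono) auto
      ultimately show False using c' unfolding D_def by linarith
    qed
    moreover have "c' < b" using D_neg[of c'] c' by (cases "b \<le> c'") auto
    ultimately show "c' = c"
      using decr[of c c'] decr[of c' c] c c' by (cases c c' rule: linorder_cases) auto
  qed
qed

lemma c_GW_properties:
  fixes \<alpha> p u :: real
  assumes \<alpha>: "0 < \<alpha>" "\<alpha> < 1" and p: "0 < p" "p < 1" and u: "u > 0"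
  defines "\<rho> \<equiv> \<alpha> * p / (1 - \<alpha> + \<alpha> * p)"
  shows c_GW_pos: "0 < c_GW \<alpha> p u"
    and c_GW_eq: "normal_tail (c_GW \<alpha> p u) = \<rho> * normal_tail (c_GW \<alpha> p u / sqrt (u + 1))"
    and c_GW_bound: "(c_GW \<alpha> p u)\<^sup>2 * (u / (u + 1)) \<le> 2 * ln (sqrt (u + 1) / \<rho>)"
proof -
  have \<alpha>p: "0 < \<alpha> * p" using \<alpha> p by simp
  have d: "1 - \<alpha> + \<alpha> * p > 0" using \<alpha> \<alpha>p by simp
  have \<rho>: "0 < \<rho>" using \<alpha>p d unfolding \<rho>_def by (rule divide_pos_pos)
  have "\<rho> < 1" using \<alpha> d by (simp add: \<rho>_def pos_divide_less_eq)
  have "sqrt (u + 1) > 1" using u by simp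
  from GW_root[OF \<rho> \<open>\<rho> < 1\<close> this]
  obtain c where c: "0 < c" "normal_tail c = \<rho> * normal_tail (c / sqrt (u + 1))"
    "c\<^sup>2 * (1 - 1 / (sqrt (u + 1))\<^sup>2) \<le> 2 * ln (sqrt (u + 1) / \<rho>)"
    "\<And>c'. normal_tail c' = \<rho> * normal_tail (c' / sqrt (u + 1)) \<Longrightarrow> c' = c"
    by metis
  have eq: "(1 - Phi c) / ((1 - p) * (1 - Phi c) + p * (1 - Phi (c / sqrt (u + 1)))) = \<alpha>
      \<longleftrightarrow> normal_tail c = \<rho> * normal_tail (c / sqrt (u + 1))" for c
  proof -
    let ?T = "(1 - p) * normal_tail c + p * normal_tail (c / sqrt (u + 1))"
    have T: "?T > 0"
      using p by (intro add_pos_pos mult_pos_pos) auto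
    have "normal_tail c / ?T = \<alpha> \<longleftrightarrow> normal_tail c = \<alpha> * ?T"
      using T by (simp add: divide_eq_eq)
    also have "\<dots> \<longleftrightarrow> (1 - \<alpha> + \<alpha> * p) * normal_tail c = \<alpha> * p * normal_tail (c / sqrt (u + 1))"
      by argo
    also have "\<dots> \<longleftrightarrow> normal_tail c = \<rho> * normal_tail (c / sqrt (u + 1))"
      using d unfolding \<rho>_def times_divide_eq_left
      by (metis less_irrefl mult.commute nonzero_eq_divide_eq)
    finally show ?thesis by (simp add: normal_tail_def)
  qed
  have "c_GW \<alpha> p u = c"
    unfolding c_GW_def eq using c(2,4) by (rule the_equality)
  moreover have "1 - 1 / (sqrt (u + 1))\<^sup>2 = u / (u + 1)" using u by (simp add: diff_divide_eq_iff)
  ultimately show "0 < c_GW \<alpha> p u" "normal_tail (c_GW \<alpha> p u) = \<rho> * normal_tail (c_GW \<alpha> p u / sqrt (u + 1))"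
    "(c_GW \<alpha> p u)\<^sup>2 * (u / (u + 1)) \<le> 2 * ln (sqrt (u + 1) / \<rho>)"
    using c(1-3) by simp_all
qed

section \<open>Multiplicative Chernoff bounds for the number of exceedances\<close>

lemma exceedance_count_measurable:
  fixes Z :: "'i \<Rightarrow> 'a \<Rightarrow> real"
  assumes "finite I" "\<And>i. i \<in> I \<Longrightarrow> Z i \<in> borel_measurable M"
  shows "(\<lambda>\<omega>. real (card {i \<in> I. Z i \<omega> \<ge> y})) \<in> borel_measurable M"
proof -
  have "(\<lambda>\<omega>. \<Sum>i\<in>I. indicator {y..} (Z i \<omega>) :: real) \<in> borel_measurable M"
    using assms(2) by (intro borel_measurable_sum measurable_compose[OF _ borel_measurable_indicator]) auto
  moreover have "(\<Sum>i\<in>I. indicator {y..} (Z i \<omega>) :: real) = real (card {i \<in> I. Z i \<omega> \<ge> y})" for \<omega>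
    using assms(1) by (simp add: indicator_def sum.If_cases Int_def)
  ultimately show ?thesis by simp
qed

context prob_space
begin

lemma exceedance_count_mgf:
  fixes Z :: "'i \<Rightarrow> 'a \<Rightarrow> real"
  assumes fin: "finite I" and indep: "indep_vars (\<lambda>_. borel) Z I"
    and q: "\<And>i. i \<in> I \<Longrightarrow> \<P>(\<omega> in M. Z i \<omega> \<ge> y) = q"
  shows "integrable M (\<lambda>\<omega>. exp (t * real (card {i \<in> I. Z i \<omega> \<ge> y})))"
    and "expectation (\<lambda>\<omega>. exp (t * real (card {i \<in> I. Z i \<omega> \<ge> y}))) = (1 + q * (exp t - 1)) ^ card I"
proof -
  define W where "W = (\<lambda>i \<omega>. 1 + (exp t - 1) * indicator {y..} (Z i \<omega>))"
  have W: "exp (t * real (card {i \<in> I. Z i \<omega> \<ge> y})) = (\<Prod>i\<in>I. W i \<omega>)" for \<omega>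
  proof -
    have "(\<Prod>i\<in>I. W i \<omega>) = (\<Prod>i\<in>I. if Z i \<omega> \<ge> y then exp t else 1)"
      by (intro prod.cong) (auto simp: W_def)
    also have "\<dots> = (\<Prod>i\<in>{i \<in> I. Z i \<omega> \<ge> y}. exp t)"
      using fin by (simp add: prod.If_cases Int_def)
    finally show ?thesis by (simp add: exp_of_nat_mult[symmetric] mult.commute)
  qed
  have meas[measurable]: "Z i \<in> borel_measurable M" if "i \<in> I" for i
    using indep that by (auto simp: indep_vars_def)
  have indepW: "indep_vars (\<lambda>_. borel) W I"
    unfolding W_def by (rule indep_vars_compose2[OF indep]) measurable
  have event: "{\<omega> \<in> space M. Z i \<omega> \<ge> y} \<in> events" if "i \<in> I" for i
    using that by measurable
  have hbi: "has_bochner_integral M (\<lambda>\<omega>. indicator {y..} (Z i \<omega>) :: real) q" if "i \<in> I" for i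
  proof -
    have "has_bochner_integral M (indicator {\<omega> \<in> space M. Z i \<omega> \<ge> y}) (prob {\<omega> \<in> space M. Z i \<omega> \<ge> y})"
      by (intro has_bochner_integral_real_indicator event[OF that]) (simp add: emeasure_eq_measure)
    then show ?thesis
      unfolding q[OF that] by (rule has_bochner_integral_cong[THEN iffD1, rotated -1]) (auto simp: indicator_def)
  qed
  have hbW: "has_bochner_integral M (W i) (1 + (exp t - 1) * q)" if "i \<in> I" for i
  proof -
    have "has_bochner_integral M (\<lambda>_. 1 :: real) 1"
      by (simp add: has_bochner_integral_iff prob_space)
    then show ?thesis
      unfolding W_def by (intro has_bochner_integral_add has_bochner_integral_mult_right hbi that)
  qed
  have intW: "integrable M (W i)" "expectation (W i) = 1 + (exp t - 1) * q" if "i \<in> I" for i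
    using hbW[OF that] by (auto simp: has_bochner_integral_iff)
  show "integrable M (\<lambda>\<omega>. exp (t * real (card {i \<in> I. Z i \<omega> \<ge> y})))"
    unfolding W by (intro indep_vars_integrable fin indepW intW)
  show "expectation (\<lambda>\<omega>. exp (t * real (card {i \<in> I. Z i \<omega> \<ge> y}))) = (1 + q * (exp t - 1)) ^ card I"
    unfolding W using indep_vars_lebesgue_integral[OF fin indepW intW(1)]
    by (simp add: intW(2) mult.commute)
qed

text \<open>Both signs of \<open>t\<close> matter: \<open>t > 0\<close> gives upper and \<open>t < 0\<close> lower tails.\<close>

lemma exceedance_count_chernoff:
  fixes Z :: "'i \<Rightarrow> 'a \<Rightarrow> real"
  assumes fin: "finite I" and indep: "indep_vars (\<lambda>_. borel) Z I"
    and q: "\<And>i. i \<in> I \<Longrightarrow> \<P>(\<omega> in M. Z i \<omega> \<ge> y) = q"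
  shows "\<P>(\<omega> in M. t * a \<le> t * real (card {i \<in> I. Z i \<omega> \<ge> y}))
    \<le> exp (real (card I) * (q * (exp t - 1)) - t * a)"
proof (cases "I = {}")
  case True
  then show ?thesis
    by (cases "t * a \<le> 0") (auto simp: prob_space)
next
  case False
  then obtain i where "i \<in> I" by auto
  then have q01: "0 \<le> q" "q \<le> 1" using q[OF \<open>i \<in> I\<close>] by (auto simp: measure_nonneg)
  have "0 \<le> (1 - q) + q * exp t" using q01 by (intro add_nonneg_nonneg mult_nonneg_nonneg) auto
  then have base: "0 \<le> 1 + q * (exp t - 1)" by (simp add: algebra_simps)
  note mgf = exceedance_count_mgf[OF fin indep q, of t]
  have "\<P>(\<omega> in M. t * a \<le> t * real (card {i \<in> I. Z i \<omega> \<ge> y}))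
      = \<P>(\<omega> in M. exp (t * a) \<le> exp (t * real (card {i \<in> I. Z i \<omega> \<ge> y})))"
    by simp
  also have "\<dots> \<le> (1 + q * (exp t - 1)) ^ card I / exp (t * a)"
    using integral_Markov_inequality_measure[OF mgf(1), of "space M" "exp (t * a)"] mgf(2) by simp
  also have "\<dots> \<le> exp (q * (exp t - 1)) ^ card I / exp (t * a)"
    by (intro divide_right_mono power_mono base exp_ge_add_one_self) auto
  also have "\<dots> = exp (real (card I) * (q * (exp t - 1)) - t * a)"
    by (simp add: exp_diff exp_of_nat_mult)
  finally show ?thesis .
qed

lemma exceedance_count_lower_tail:
  fixes Z :: "'i \<Rightarrow> 'a \<Rightarrow> real"
  assumes fin: "finite I" and indep: "indep_vars (\<lambda>_. borel) Z I"
    and q: "\<And>i. i \<in> I \<Longrightarrow> \<P>(\<omega> in M. Z i \<omega> \<ge> y) = q"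
  shows "\<P>(\<omega> in M. real (card {i \<in> I. Z i \<omega> \<ge> y}) \<le> real (card I) * q / 2)
    \<le> exp (- ((1 - ln 2) / 2 * (real (card I) * q)))"
proof -
  have "\<P>(\<omega> in M. real (card {i \<in> I. Z i \<omega> \<ge> y}) \<le> real (card I) * q / 2)
    = \<P>(\<omega> in M. (- ln 2) * (real (card I) * q / 2) \<le> (- ln 2) * real (card {i \<in> I. Z i \<omega> \<ge> y}))"
    by simp
  also have "\<dots> \<le> exp (real (card I) * (q * (exp (- ln 2) - 1)) - (- ln 2) * (real (card I) * q / 2))"
    by (rule exceedance_count_chernoff[OF fin indep q])
  also have "real (card I) * (q * (exp (- ln 2) - 1)) - (- ln 2) * (real (card I) * q / 2)
    = - ((1 - ln 2) / 2 * (real (card I) * q))"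
    by (simp add: exp_minus field_simps)
  finally show ?thesis .
qed

text \<open>The choice \<open>exp t = 1 / \<theta>\<close> is optimal for the mean \<open>\<theta> g\<close> per variable.\<close>

lemma exceedance_count_upper_tail:
  fixes Z :: "'i \<Rightarrow> 'a \<Rightarrow> real"
  assumes fin: "finite I" and indep: "indep_vars (\<lambda>_. borel) Z I"
    and q: "\<And>i. i \<in> I \<Longrightarrow> \<P>(\<omega> in M. Z i \<omega> \<ge> y) = q"
    and \<theta>: "0 < \<theta>" "\<theta> < 1" and g: "q \<le> \<theta> * g"
  shows "\<P>(\<omega> in M. real (card {i \<in> I. Z i \<omega> \<ge> y}) \<ge> real (card I) * g)
    \<le> exp (- ((\<theta> - 1 - ln \<theta>) * (real (card I) * g)))"
proof -
  let ?t = "- ln \<theta>"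
  have t: "?t > 0" using \<theta> by simp
  have e: "exp ?t = 1 / \<theta>" using \<theta> by (simp add: exp_minus inverse_eq_divide)
  have "q * (exp ?t - 1) \<le> \<theta> * g * (exp ?t - 1)"
    using g t by (intro mult_right_mono) auto
  also have "\<dots> = (1 - \<theta>) * g" using \<theta> by (simp add: e field_simps)
  finally have "real (card I) * (q * (exp ?t - 1)) \<le> real (card I) * ((1 - \<theta>) * g)"
    by (intro mult_left_mono) auto
  then have le: "real (card I) * (q * (exp ?t - 1)) - ?t * (real (card I) * g)
      \<le> - ((\<theta> - 1 - ln \<theta>) * (real (card I) * g))"
    by (simp add: algebra_simps)
  have "\<P>(\<omega> in M. real (card {i \<in> I. Z i \<omega> \<ge> y}) \<ge> real (card I) * g)
    = \<P>(\<omega> in M. ?t * (real (card I) * g) \<le> ?t * real (card {i \<in> I. Z i \<omega> \<ge> y}))"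
    using t by (simp only: mult_le_cancel_left_pos)
  also have "\<dots> \<le> exp (real (card I) * (q * (exp ?t - 1)) - ?t * (real (card I) * g))"
    by (rule exceedance_count_chernoff[OF fin indep q])
  also have "\<dots> \<le> exp (- ((\<theta> - 1 - ln \<theta>) * (real (card I) * g)))"
    using le by simp
  finally show ?thesis .
qed

end

section \<open>The two-groups model\<close>

text \<open>The common two-sided tail \<open>P(Z\<^sub>i \<ge> y)\<close>, for \<open>y > 0\<close>, of the test statistics.\<close>

definition two_groups_tail :: "real \<Rightarrow> real \<Rightarrow> real \<Rightarrow> real" where
  "two_groups_tail p u y = 2 * ((1 - p) * normal_tail y + p * normal_tail (y / sqrt (u + 1)))"

lemma two_groups_indep:
  assumes "two_groups_model M m p \<sigma> \<tau> \<nu> X"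
  shows "prob_space.indep_vars M (\<lambda>_. borel) (\<lambda>i \<omega>. \<bar>X i \<omega>\<bar> / \<sigma>) {1..m}"
proof -
  interpret prob_space M using assms by (simp add: two_groups_model_def)
  have "indep_vars (\<lambda>_. count_space UNIV \<Otimes>\<^sub>M borel) (\<lambda>i \<omega>. (\<nu> i \<omega>, X i \<omega>)) {1..m}"
    using assms by (simp add: two_groups_model_def)
  from indep_vars_compose2[OF this, of "\<lambda>_ z. \<bar>snd z\<bar> / \<sigma>" "\<lambda>_. borel"]
  show ?thesis by simp
qed

lemma two_groups_exceedance:
  assumes model: "two_groups_model M m p \<sigma> \<tau> \<nu> X" and p: "0 < p" "p < 1"
    and \<sigma>: "\<sigma> > 0" and i: "i \<in> {1..m}" and y: "y > 0"
  shows "\<P>(\<omega> in M. \<bar>X i \<omega>\<bar> / \<sigma> \<ge> y) = two_groups_tail p (\<tau>\<^sup>2 / \<sigma>\<^sup>2) y"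
proof -
  interpret prob_space M using model by (simp add: two_groups_model_def)
  have "random_variable (count_space UNIV \<Otimes>\<^sub>M borel) (\<lambda>\<omega>. (\<nu> i \<omega>, X i \<omega>))"
    using model i by (auto simp: two_groups_model_def indep_vars_def)
  from measurable_compose[OF this measurable_fst] measurable_compose[OF this measurable_snd]
  have [measurable]: "\<nu> i \<in> measurable M (count_space UNIV)" "X i \<in> borel_measurable M"
    by simp_all
  let ?B = "{x. \<bar>x\<bar> / \<sigma> \<ge> y}"
  let ?E = "\<lambda>j. {\<omega> \<in> space M. X i \<omega> \<in> ?B \<and> \<nu> i \<omega> = j}"
  have B: "?B \<in> sets borel" by measurable
  have \<nu>: "prob {\<omega> \<in> space M. \<nu> i \<omega> = 1} = p" "prob {\<omega> \<in> space M. \<nu> i \<omega> = 0} = 1 - p"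
    and cond: "\<P>(\<omega> in M. X i \<omega> \<in> ?B \<bar> \<nu> i \<omega> = 0) = measure (normal_distribution 0 \<sigma>) ?B"
      "\<P>(\<omega> in M. X i \<omega> \<in> ?B \<bar> \<nu> i \<omega> = 1) = measure (normal_distribution 0 (sqrt (\<sigma>\<^sup>2 + \<tau>\<^sup>2))) ?B"
    using model i B unfolding two_groups_model_def by blast+
  have sq: "sqrt (\<sigma>\<^sup>2 + \<tau>\<^sup>2) > 0" using \<sigma> by (simp add: add_pos_nonneg)
  have "sqrt (\<sigma>\<^sup>2 + \<tau>\<^sup>2) = \<sigma> * sqrt (\<tau>\<^sup>2 / \<sigma>\<^sup>2 + 1)"
  proof -
    have "\<sigma>\<^sup>2 + \<tau>\<^sup>2 = \<sigma>\<^sup>2 * (\<tau>\<^sup>2 / \<sigma>\<^sup>2 + 1)" using \<sigma> by (simp add: algebra_simps)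
    then show ?thesis using \<sigma> by (simp add: real_sqrt_mult)
  qed
  then have scale: "y * \<sigma> / sqrt (\<sigma>\<^sup>2 + \<tau>\<^sup>2) = y / sqrt (\<tau>\<^sup>2 / \<sigma>\<^sup>2 + 1)"
    using \<sigma> by simp
  have E0: "prob (?E 0) = (1 - p) * (2 * normal_tail y)"
  proof -
    have "measure (normal_distribution 0 \<sigma>) ?B = 2 * normal_tail y"
      using measure_normal_two_sided[OF \<sigma> \<sigma> y] \<sigma> by simp
    then show ?thesis using cond(1) \<nu> p by (simp add: cond_prob_def field_simps)
  qed
  have E1: "prob (?E 1) = p * (2 * normal_tail (y / sqrt (\<tau>\<^sup>2 / \<sigma>\<^sup>2 + 1)))"
  proof -
    have "measure (normal_distribution 0 (sqrt (\<sigma>\<^sup>2 + \<tau>\<^sup>2))) ?B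
        = 2 * normal_tail (y / sqrt (\<tau>\<^sup>2 / \<sigma>\<^sup>2 + 1))"
      using measure_normal_two_sided[OF sq \<sigma> y] by (simp only: scale)
    then show ?thesis using cond(2) \<nu> p by (simp add: cond_prob_def field_simps)
  qed
  \<comment> \<open>The label is a natural number, but \<open>0\<close> and \<open>1\<close> carry all the mass.\<close>
  have "prob ({\<omega> \<in> space M. \<nu> i \<omega> = 0} \<union> {\<omega> \<in> space M. \<nu> i \<omega> = 1})
      = prob {\<omega> \<in> space M. \<nu> i \<omega> = 0} + prob {\<omega> \<in> space M. \<nu> i \<omega> = 1}"
    by (intro finite_measure_Union) auto
  also have "\<dots> = 1" using \<nu> by simp
  finally have "AE \<omega> in M. \<omega> \<in> {\<omega> \<in> space M. \<nu> i \<omega> = 0} \<union> {\<omega> \<in> space M. \<nu> i \<omega> = 1}"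
    by (rule AE_prob_1)
  then have "prob {\<omega> \<in> space M. X i \<omega> \<in> ?B} = prob (?E 0 \<union> ?E 1)"
    by (intro finite_measure_eq_AE) (auto elim!: eventually_mono)
  also have "\<dots> = prob (?E 0) + prob (?E 1)"
    by (intro finite_measure_Union) auto
  finally show ?thesis
    unfolding E0 E1 by (simp add: two_groups_tail_def algebra_simps)
qed

section \<open>The Benjamini--Hochberg threshold\<close>

lemma c_Bon_eq:
  assumes "0 < \<alpha>" "\<alpha> < 1" "m \<ge> 1"
  shows "normal_tail (c_Bon \<alpha> m) = \<alpha> / (2 * real m)"
proof -
  have "\<alpha> / (2 * real m) < 1" using assms by (simp add: divide_less_eq)
  moreover have "0 < \<alpha> / (2 * real m)" using assms by simp
  ultimately obtain c where c: "normal_tail c = \<alpha> / (2 * real m)"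
    using normal_tail_surj by blast
  have "c_Bon \<alpha> m = c"
    unfolding c_Bon_def normal_tail_def[symmetric]
  proof (rule the_equality[where a = c])
    show "x = c" if "normal_tail x = \<alpha> / (2 * real m)" for x
      using that c by (metis normal_tail_eq_iff)
  qed (fact c)
  with c show ?thesis by simp
qed

lemma BH_ratio_le_iff:
  assumes "m \<ge> 1"
  shows "BH_ratio m z y \<le> ereal \<alpha>
    \<longleftrightarrow> 2 * real m * normal_tail y \<le> \<alpha> * real (card {i \<in> {1..m}. z i \<ge> y})"
proof (cases "card {i \<in> {1..m}. z i \<ge> y} = 0")
  case True
  have "\<not> real m * normal_tail y \<le> 0" using assms by (simp add: not_le)
  then show ?thesis unfolding BH_ratio_def emp_tail_def True by simp
next
  case False
  define n where "n = card {i \<in> {1..m}. z i \<ge> y}"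
  have n: "real n > 0" using False unfolding n_def by linarith
  have "2 * normal_tail y / (real n / real m) \<le> \<alpha> \<longleftrightarrow> 2 * real m * normal_tail y \<le> \<alpha> * real n"
    using n by (simp add: pos_divide_le_eq mult_ac)
  then show ?thesis
    using n assms unfolding BH_ratio_def emp_tail_def n_def[symmetric] normal_tail_def[symmetric] by simp
qed

lemma c_BH_gt_imp:
  assumes "m \<ge> 1" "c_BH \<alpha> m z > ereal y"
  shows "\<alpha> * real (card {i \<in> {1..m}. z i \<ge> y}) < 2 * real m * normal_tail y"
proof (rule ccontr)
  assume "\<not> ?thesis"
  then have "BH_ratio m z y \<le> ereal \<alpha>" using BH_ratio_le_iff[OF assms(1)] by simp
  then have "c_BH_tilde \<alpha> m z \<le> ereal y"
    unfolding c_BH_tilde_def by (intro Inf_lower) auto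
  moreover have "ereal y < c_BH_tilde \<alpha> m z" using assms(2) by (simp add: c_BH_def)
  ultimately show False by (meson leD)
qed

text \<open>If the ratio is at most \<open>\<alpha>\<close> somewhere, then it also is at one of the \<open>m\<close> deterministic points \<open>t\<close>
  with \<open>2 (1 - \<Phi>(t)) = \<alpha> k / m\<close>: with \<open>k\<close> exceedances of the given point, the point \<open>t\<close> is not to the right of that point.
  Only finitely many events therefore have to be controlled.\<close>

lemma c_BH_less_imp:
  assumes m: "m \<ge> 1" and \<alpha>: "0 < \<alpha>" "\<alpha> < 1" and y: "y \<le> c_Bon \<alpha> m"
    and less: "c_BH \<alpha> m z < ereal y"
  obtains k t where "k \<in> {1..m}" "2 * real m * normal_tail t = \<alpha> * real k" "t < y"
    "k \<le> card {i \<in> {1..m}. z i \<ge> t}"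
proof -
  have "c_BH_tilde \<alpha> m z < ereal y" using less y by (auto simp: c_BH_def min_less_iff_disj)
  then obtain x where x: "x < y" "BH_ratio m z x \<le> ereal \<alpha>"
    by (auto simp: c_BH_tilde_def Inf_less_iff)
  define k where "k = card {i \<in> {1..m}. z i \<ge> x}"
  have le: "2 * real m * normal_tail x \<le> \<alpha> * real k"
    using x(2) BH_ratio_le_iff[OF m] by (simp add: k_def)
  have "0 < 2 * real m * normal_tail x" using m by simp
  with le have "0 < \<alpha> * real k" by linarith
  then have k1: "k \<ge> 1" using \<alpha> by (cases k) auto
  have "k \<le> card {1..m}" unfolding k_def by (intro card_mono) auto
  then have km: "k \<le> m" by simp
  have "\<alpha> * real k < 2 * real m"
  proof -
    have "\<alpha> * real k \<le> 1 * real m" using \<alpha> km by (intro mult_mono) auto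
    then show ?thesis using m by simp
  qed
  then have "0 < \<alpha> * real k / (2 * real m)" "\<alpha> * real k / (2 * real m) < 1"
    using \<alpha> k1 m by auto
  then obtain t where t: "normal_tail t = \<alpha> * real k / (2 * real m)"
    using normal_tail_surj by blast
  then have t': "2 * real m * normal_tail t = \<alpha> * real k" using m by simp
  with le have "2 * real m * normal_tail x \<le> 2 * real m * normal_tail t" by simp
  then have "t \<le> x" using m by simp
  then have "k \<le> card {i \<in> {1..m}. z i \<ge> t}"
    unfolding k_def by (intro card_mono) auto
  with k1 km t' \<open>t \<le> x\<close> x(1) show thesis by (intro that[of k t]) auto
qed

section \<open>A non-asymptotic deviation bound\<close>

text \<open>Here \<open>\<kappa>\<close> bounds from below the probability that a signal exceeds \<open>c + \<epsilon>\<close> in one direction, and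
  the two exponential hypotheses say that a shift by \<open>\<epsilon>\<close> near \<open>c\<close> changes the normal tail by a large
  factor. The last hypothesis puts the Bonferroni threshold to the right of \<open>c\<close>. The first summand bounds the probability of \<open>c_BH > c + \<epsilon>\<close>, the second one that of
  \<open>c_BH < c - \<epsilon>\<close>.\<close>

lemma BH_deviation_bound:
  fixes \<alpha> p \<sigma> \<tau> u \<epsilon> A \<kappa> :: real
  assumes model: "two_groups_model M m p \<sigma> \<tau> \<nu> X" and m: "m \<ge> 1"
    and p: "0 < p" "p < 1" and \<sigma>: "\<sigma> > 0" and \<tau>: "\<tau> > 0" and u: "u = \<tau>\<^sup>2 / \<sigma>\<^sup>2"
    and \<alpha>: "0 < \<alpha>" "\<alpha> \<le> A" and A: "A < 1" and \<epsilon>: "\<epsilon> > 0" and \<kappa>: "\<kappa> > 0"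
  defines "c \<equiv> c_GW \<alpha> p u" and "\<theta> \<equiv> (1 + A) / 2"
  assumes c\<epsilon>: "\<epsilon> \<le> c"
    and h\<kappa>: "\<kappa> \<le> normal_tail ((c + \<epsilon>) / sqrt (u + 1))"
    and h1: "exp (- (c * \<epsilon>)) \<le> (1 - A) * \<kappa>"
    and h2: "exp (- ((c - \<epsilon>) * \<epsilon>)) \<le> (1 - A) * \<kappa>"
    and h3: "1 \<le> 2 * \<kappa> * (real m * p)"
  shows "\<P>(\<omega> in M. \<bar>c_BH \<alpha> m (\<lambda>i. \<bar>X i \<omega>\<bar> / \<sigma>) - ereal c\<bar> > ereal \<epsilon>)
    \<le> exp (- ((1 - ln 2) * \<kappa> * (real m * p)))
      + real m * exp (- ((\<theta> - 1 - ln \<theta>) * 2 * \<kappa> * (real m * p)))"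
proof -
  interpret prob_space M using model by (simp add: two_groups_model_def)
  define Z where "Z = (\<lambda>i \<omega>. \<bar>X i \<omega>\<bar> / \<sigma>)"
  define N where "N = (\<lambda>y \<omega>. real (card {i \<in> {1..m}. Z i \<omega> \<ge> y}))"
  define T where "T = two_groups_tail p u"
  define w where "w = sqrt (u + 1)"
  have u0: "u > 0" using \<sigma> \<tau> u by simp
  then have w: "w > 1" by (simp add: w_def)
  have \<alpha>1: "\<alpha> < 1" using \<alpha> A by simp
  have \<theta>: "0 < \<theta>" "\<theta> < 1" using \<alpha> A by (auto simp: \<theta>_def)
  have \<gamma>: "0 \<le> \<theta> - 1 - ln \<theta>" using ln_le_minus_one[OF \<theta>(1)] by simp
  have indep: "indep_vars (\<lambda>_. borel) Z {1..m}"
    unfolding Z_def by (rule two_groups_indep[OF model])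
  have T: "\<P>(\<omega> in M. Z i \<omega> \<ge> y) = T y" if "i \<in> {1..m}" "y > 0" for i y
    unfolding Z_def T_def u by (rule two_groups_exceedance[OF model p \<sigma> that])
  have N[measurable]: "N y \<in> borel_measurable M" for y
    unfolding N_def using indep by (intro exceedance_count_measurable) (auto simp: indep_vars_def)

  define \<rho> where "\<rho> = \<alpha> * p / (1 - \<alpha> + \<alpha> * p)"
  note GW = c_GW_properties[OF \<alpha>(1) \<alpha>1 p u0, folded c_def \<rho>_def w_def]
  have "\<alpha> * p > 0" using \<alpha> p by simp
  have "\<alpha> * p \<le> \<alpha> * 1" using \<alpha> p by (intro mult_left_mono) auto
  have \<rho>_ge: "\<alpha> * p \<le> \<rho>"
    unfolding \<rho>_def using \<open>\<alpha> * p > 0\<close> \<open>\<alpha> * p \<le> \<alpha> * 1\<close> \<alpha>1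
    by (simp add: pos_le_divide_eq mult_left_le)
  have \<rho>_le: "\<rho> \<le> \<alpha> * p / (1 - A)"
    unfolding \<rho>_def using \<open>\<alpha> * p > 0\<close> \<alpha> A by (intro divide_left_mono mult_pos_pos) auto
  have "normal_tail ((c + \<epsilon>) / w) \<le> normal_tail (c / w)"
    using w \<epsilon> by (simp add: divide_right_mono)
  then have Qcw: "\<kappa> \<le> normal_tail (c / w)" using h\<kappa>[folded w_def] by (rule order_trans[rotated])
  have Q_half: "normal_tail x \<le> 1 / 2" if "x \<ge> 0" for x
    using that normal_tail_zero by (metis normal_tail_le_iff)
  have Qc_ge: "\<alpha> * p * \<kappa> \<le> normal_tail c"
    unfolding GW(2) using \<rho>_ge Qcw \<open>\<alpha> * p > 0\<close> \<kappa> by (intro mult_mono) auto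
  have Qc_le: "normal_tail c \<le> \<alpha> * p / (1 - A) * (1 / 2)"
    unfolding GW(2) using \<rho>_le Q_half[of "c / w"] GW(1) w \<open>\<alpha> * p > 0\<close> A
    by (intro mult_mono) (auto intro: less_imp_le)

  have T_ge: "T (c + \<epsilon>) \<ge> 2 * p * \<kappa>"
  proof -
    have "p * \<kappa> \<le> (1 - p) * normal_tail (c + \<epsilon>) + p * normal_tail ((c + \<epsilon>) / w)"
      using p h\<kappa> by (intro add_increasing mult_left_mono mult_nonneg_nonneg)
        (auto simp: w_def intro: less_imp_le)
    then show ?thesis by (simp add: T_def two_groups_tail_def w_def)
  qed
  have upper: "\<P>(\<omega> in M. N (c + \<epsilon>) \<omega> \<le> real m * T (c + \<epsilon>) / 2)
      \<le> exp (- ((1 - ln 2) * \<kappa> * (real m * p)))"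
  proof -
    have "\<P>(\<omega> in M. N (c + \<epsilon>) \<omega> \<le> real m * T (c + \<epsilon>) / 2)
        \<le> exp (- ((1 - ln 2) / 2 * (real m * T (c + \<epsilon>))))"
      using exceedance_count_lower_tail[OF _ indep T, of "c + \<epsilon>"] GW(1) \<epsilon> by (simp add: N_def)
    also have "\<dots> \<le> exp (- ((1 - ln 2) * \<kappa> * (real m * p)))"
    proof -
      have "(1 - ln 2) / 2 * (real m * (2 * p * \<kappa>)) \<le> (1 - ln 2) / 2 * (real m * T (c + \<epsilon>))"
        using T_ge ln_2_less_1 by (intro mult_left_mono) auto
      moreover have "(1 - ln 2) / 2 * (real m * (2 * p * \<kappa>)) = (1 - ln 2) * \<kappa> * (real m * p)" by simp
      ultimately show ?thesis by (simp only: exp_le_cancel_iff neg_le_iff_le)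
    qed
    finally show ?thesis .
  qed
  have upperD: "N (c + \<epsilon>) \<omega> \<le> real m * T (c + \<epsilon>) / 2"
    if "c_BH \<alpha> m (\<lambda>i. Z i \<omega>) > ereal (c + \<epsilon>)" for \<omega>
  proof -
    from c_BH_gt_imp[OF m that] have "\<alpha> * N (c + \<epsilon>) \<omega> < 2 * real m * normal_tail (c + \<epsilon>)"
      by (simp add: N_def)
    also have "\<dots> \<le> 2 * real m * ((1 - A) * \<kappa> * (\<alpha> * p / (1 - A) * (1 / 2)))"
    proof (intro mult_left_mono)
      have "normal_tail (c + \<epsilon>) \<le> exp (- (c * \<epsilon>)) * normal_tail c"
        using GW(1) \<epsilon> by (intro normal_tail_shift) auto
      also have "\<dots> \<le> (1 - A) * \<kappa> * (\<alpha> * p / (1 - A) * (1 / 2))"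
        using h1 Qc_le A \<kappa> by (intro mult_mono) (auto intro: less_imp_le)
      finally show "normal_tail (c + \<epsilon>) \<le> (1 - A) * \<kappa> * (\<alpha> * p / (1 - A) * (1 / 2))" .
    qed auto
    also have "\<dots> = \<alpha> * (real m * (2 * p * \<kappa>) / 2)" using A by (simp add: field_simps)
    also have "\<dots> \<le> \<alpha> * (real m * T (c + \<epsilon>) / 2)"
      using T_ge \<alpha> by (intro mult_left_mono divide_right_mono) auto
    finally show ?thesis using \<alpha> by simp
  qed

  have cBon: "c - \<epsilon> \<le> c_Bon \<alpha> m"
  proof -
    have "\<alpha> * 1 \<le> \<alpha> * (2 * \<kappa> * (real m * p))" using h3 \<alpha> by (intro mult_left_mono) auto
    then have "\<alpha> / (2 * real m) \<le> \<alpha> * p * \<kappa>" using m by (simp add: divide_le_eq mult_ac)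
    also note Qc_ge
    finally have "normal_tail (c_Bon \<alpha> m) \<le> normal_tail c" using c_Bon_eq[OF \<alpha>(1) \<alpha>1 m] by simp
    then show ?thesis using \<epsilon> by simp
  qed

  have "\<exists>t. 2 * real m * normal_tail t = \<alpha> * real k" if "k \<in> {1..m}" for k
  proof -
    have "\<alpha> * real k \<le> 1 * real m" using that \<alpha> \<alpha>1 by (intro mult_mono) auto
    then have "0 < \<alpha> * real k / (2 * real m)" "\<alpha> * real k / (2 * real m) < 1" using that \<alpha> m by auto
    then obtain t where "normal_tail t = \<alpha> * real k / (2 * real m)" using normal_tail_surj by blast
    then have "2 * real m * normal_tail t = \<alpha> * real k" using m by simp
    then show ?thesis ..
  qed
  then obtain t where t: "\<And>k. k \<in> {1..m} \<Longrightarrow> 2 * real m * normal_tail (t k) = \<alpha> * real k"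
    by metis
  define K where "K = {k \<in> {1..m}. t k < c - \<epsilon>}"
  have lower: "\<P>(\<omega> in M. N (t k) \<omega> \<ge> real k)
      \<le> exp (- ((\<theta> - 1 - ln \<theta>) * 2 * \<kappa> * (real m * p)))" if "k \<in> K" for k
  proof -
    have k: "k \<in> {1..m}" "t k < c - \<epsilon>" using that by (auto simp: K_def)
    define g where "g = real k / real m"
    have mg: "real m * g = real k" using m by (simp add: g_def)
    have Qg: "2 * normal_tail (t k) = \<alpha> * g"
      using t[OF k(1)] m by (simp add: g_def field_simps)
    have g01: "0 < g" "g \<le> 1" using k m by (auto simp: g_def)
    have "\<alpha> * g \<le> \<alpha> * 1" using \<alpha> g01 by (intro mult_left_mono) auto
    then have "\<alpha> * g < 1" using \<alpha>1 by simp
    with Qg normal_tail_zero have "normal_tail (t k) < normal_tail 0" by linarith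
    then have t0: "t k > 0" by simp
    \<comment> \<open>The signals contribute at most \<open>p\<close>, which is negligible against \<open>g\<close> to the left of \<open>c - \<epsilon>\<close>.\<close>
    have g_ge: "exp ((c - \<epsilon>) * \<epsilon>) * (2 * p * \<kappa>) \<le> g"
    proof -
      have "normal_tail (c - \<epsilon> + \<epsilon>) \<le> exp (- ((c - \<epsilon>) * \<epsilon>)) * normal_tail (c - \<epsilon>)"
        using c\<epsilon> \<epsilon> by (intro normal_tail_shift) auto
      also have "\<dots> \<le> exp (- ((c - \<epsilon>) * \<epsilon>)) * normal_tail (t k)"
        using k(2) by (intro mult_left_mono) auto
      finally have "exp ((c - \<epsilon>) * \<epsilon>) * normal_tail c
          \<le> exp ((c - \<epsilon>) * \<epsilon>) * (exp (- ((c - \<epsilon>) * \<epsilon>)) * normal_tail (t k))"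
        by (intro mult_left_mono) auto
      also have "\<dots> = normal_tail (t k)" by (simp add: mult.assoc[symmetric] mult_exp_exp)
      finally have "exp ((c - \<epsilon>) * \<epsilon>) * normal_tail c \<le> normal_tail (t k)" .
      moreover have "exp ((c - \<epsilon>) * \<epsilon>) * (\<alpha> * p * \<kappa>) \<le> exp ((c - \<epsilon>) * \<epsilon>) * normal_tail c"
        using Qc_ge by (intro mult_left_mono) auto
      moreover have "\<alpha> * (exp ((c - \<epsilon>) * \<epsilon>) * (2 * p * \<kappa>)) = 2 * (exp ((c - \<epsilon>) * \<epsilon>) * (\<alpha> * p * \<kappa>))"
        by simp
      ultimately have "\<alpha> * (exp ((c - \<epsilon>) * \<epsilon>) * (2 * p * \<kappa>)) \<le> \<alpha> * g"
        unfolding Qg[symmetric] by linarith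
      then show ?thesis using \<alpha> by simp
    qed
    have p\<kappa>: "0 < 2 * p * \<kappa>" using p \<kappa> by simp
    have "1 \<le> exp ((c - \<epsilon>) * \<epsilon>)" using c\<epsilon> \<epsilon> by simp
    then have g_ge': "2 * p * \<kappa> \<le> g"
      using mult_right_mono[of 1 "exp ((c - \<epsilon>) * \<epsilon>)" "2 * p * \<kappa>"] p\<kappa> g_ge by linarith
    have "p \<le> (1 - A) / 2 * g"
    proof -
      have "1 \<le> (1 - A) * \<kappa> * exp ((c - \<epsilon>) * \<epsilon>)"
        using h2 by (simp add: exp_minus inverse_eq_divide divide_le_eq)
      then have "p * 1 \<le> p * ((1 - A) * \<kappa> * exp ((c - \<epsilon>) * \<epsilon>))" using p by (intro mult_left_mono) auto
      also have "\<dots> = (1 - A) / 2 * (exp ((c - \<epsilon>) * \<epsilon>) * (2 * p * \<kappa>))" by simp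
      also have "\<dots> \<le> (1 - A) / 2 * g" using g_ge A by (intro mult_left_mono) auto
      finally show ?thesis by simp
    qed
    moreover have "T (t k) \<le> \<alpha> * g + p"
    proof -
      have "(1 - p) * normal_tail (t k) \<le> 1 * normal_tail (t k)"
        using p by (intro mult_right_mono) (auto intro: less_imp_le)
      moreover have "p * normal_tail (t k / w) \<le> p * (1 / 2)"
        using p t0 w by (intro mult_left_mono Q_half) auto
      ultimately have "2 * ((1 - p) * normal_tail (t k) + p * normal_tail (t k / w))
          \<le> 2 * (1 * normal_tail (t k) + p * (1 / 2))"
        by (rule mult_left_mono[OF add_mono]) simp
      also have "\<dots> = \<alpha> * g + p" unfolding Qg[symmetric] by simp
      finally show ?thesis by (simp add: T_def two_groups_tail_def w_def)
    qed
    moreover have "\<alpha> * g \<le> A * g" using \<alpha> g01 by (intro mult_right_mono) auto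
    ultimately have "T (t k) \<le> A * g + (1 - A) / 2 * g" by linarith
    also have "\<dots> = \<theta> * g" by (simp add: \<theta>_def field_simps)
    finally have "T (t k) \<le> \<theta> * g" .
    then have "\<P>(\<omega> in M. N (t k) \<omega> \<ge> real m * g) \<le> exp (- ((\<theta> - 1 - ln \<theta>) * (real m * g)))"
      using exceedance_count_upper_tail[OF _ indep T, of "t k" \<theta> g] t0 \<theta> by (simp add: N_def)
    also have "\<dots> \<le> exp (- ((\<theta> - 1 - ln \<theta>) * 2 * \<kappa> * (real m * p)))"
    proof -
      have "(\<theta> - 1 - ln \<theta>) * (real m * (2 * p * \<kappa>)) \<le> (\<theta> - 1 - ln \<theta>) * (real m * g)"
        using g_ge' \<gamma> by (intro mult_left_mono) auto
      then show ?thesis by (simp add: mult_ac)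
    qed
    finally show ?thesis unfolding mg .
  qed

  let ?D = "{\<omega> \<in> space M. \<bar>c_BH \<alpha> m (\<lambda>i. Z i \<omega>) - ereal c\<bar> > ereal \<epsilon>}"
  let ?U = "{\<omega> \<in> space M. N (c + \<epsilon>) \<omega> \<le> real m * T (c + \<epsilon>) / 2}"
  let ?L = "\<lambda>k. {\<omega> \<in> space M. N (t k) \<omega> \<ge> real k}"
  have finK: "finite K" by (simp add: K_def)
  have "card K \<le> card {1..m}" by (intro card_mono) (auto simp: K_def)
  then have cardK: "card K \<le> m" by simp
  have "?D \<subseteq> ?U \<union> (\<Union>k\<in>K. ?L k)"
  proof
    fix \<omega> assume "\<omega> \<in> ?D"
    then have \<omega>: "\<omega> \<in> space M" "\<bar>c_BH \<alpha> m (\<lambda>i. Z i \<omega>) - ereal c\<bar> > ereal \<epsilon>" by auto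
    then consider "c_BH \<alpha> m (\<lambda>i. Z i \<omega>) > ereal (c + \<epsilon>)" | "c_BH \<alpha> m (\<lambda>i. Z i \<omega>) < ereal (c - \<epsilon>)"
      by (cases "c_BH \<alpha> m (\<lambda>i. Z i \<omega>)") (auto simp: abs_if split: if_splits)
    then show "\<omega> \<in> ?U \<union> (\<Union>k\<in>K. ?L k)"
    proof cases
      case 1
      then show ?thesis using upperD \<omega> by auto
    next
      case 2
      then obtain k x where k: "k \<in> {1..m}" "2 * real m * normal_tail x = \<alpha> * real k" "x < c - \<epsilon>"
        "k \<le> card {i \<in> {1..m}. Z i \<omega> \<ge> x}"
        by (rule c_BH_less_imp[OF m \<alpha>(1) \<alpha>1 cBon])
      then have "2 * real m * normal_tail x = 2 * real m * normal_tail (t k)"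
        using t[OF k(1)] by linarith
      then have "x = t k" using m by simp
      with k \<omega> show ?thesis by (auto simp: K_def N_def)
    qed
  qed
  then have "prob ?D \<le> prob (?U \<union> (\<Union>k\<in>K. ?L k))"
    by (intro finite_measure_mono) (use finK in measurable)
  also have "\<dots> \<le> prob ?U + prob (\<Union>k\<in>K. ?L k)"
    using finK by (intro measure_Un_le) measurable
  also have "prob (\<Union>k\<in>K. ?L k) \<le> (\<Sum>k\<in>K. prob (?L k))"
    by (intro finite_measure_subadditive_finite finK) auto
  also have "\<dots> \<le> (\<Sum>k\<in>K. exp (- ((\<theta> - 1 - ln \<theta>) * 2 * \<kappa> * (real m * p))))"
    by (intro sum_mono lower)
  also have "\<dots> \<le> real m * exp (- ((\<theta> - 1 - ln \<theta>) * 2 * \<kappa> * (real m * p)))"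
    using cardK by simp
  finally show ?thesis using upper by (simp add: Z_def)
qed

section \<open>Asymptotics\<close>

text \<open>The ratio \<open>f / r\<close> determines the size of the threshold: if \<open>ln (f / r)\<close> is of order \<open>u\<close>, then the
  threshold is of order \<open>sqrt (u + 1)\<close>, the standard deviation of a signal.\<close>

lemma c_GW_le_signal_scale:
  fixes \<alpha> p u C :: real
  assumes \<alpha>: "0 < \<alpha>" "\<alpha> < 1" and p: "0 < p" "p \<le> 1 / 2" and u: "u \<ge> 1"
    and R: "(1 - p) / p / (\<alpha> / (1 - \<alpha>)) \<ge> 1"
    and lnR: "ln ((1 - p) / p / (\<alpha> / (1 - \<alpha>))) \<le> 2 * C * u"
  shows "(c_GW \<alpha> p u)\<^sup>2 \<le> (5 + 4 * C) * (u + 1)"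
proof -
  define R where "R = (1 - p) / p / (\<alpha> / (1 - \<alpha>))"
  define \<rho> where "\<rho> = \<alpha> * p / (1 - \<alpha> + \<alpha> * p)"
  have u0: "u > 0" and p1: "p < 1" using u p by auto
  have \<alpha>p: "\<alpha> * p > 0" using \<alpha> p by simp
  have "1 - \<alpha> + \<alpha> * p > 0" using \<alpha> \<alpha>p by simp
  then have \<rho>: "\<rho> > 0" using \<alpha>p unfolding \<rho>_def by simp
  have R1: "R \<ge> 1" using R by (simp only: R_def)
  have "1 / \<rho> \<le> 3 * R"
  proof -
    have "1 / \<rho> = (1 - \<alpha>) / (\<alpha> * p) + 1"
      using \<alpha> p by (simp add: \<rho>_def add_divide_distrib)
    also have "\<dots> \<le> 2 * R + R"
    proof (intro add_mono)
      have "(1 - \<alpha>) / (\<alpha> * p) * 1 \<le> (1 - \<alpha>) / (\<alpha> * p) * (2 * (1 - p))"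
        using \<alpha> \<alpha>p p by (intro mult_left_mono) auto
      also have "\<dots> = 2 * R"
        by (simp only: R_def divide_divide_eq_left divide_divide_eq_right
            times_divide_eq_left times_divide_eq_right mult_ac)
      finally show "(1 - \<alpha>) / (\<alpha> * p) \<le> 2 * R" by simp
    qed (rule R1)
    finally show ?thesis by simp
  qed
  then have "ln (1 / \<rho>) \<le> ln (3 * R)" using \<rho> by (intro ln_mono) auto
  also have "\<dots> = ln 3 + ln R" using R1 by (simp add: ln_mult)
  also have "\<dots> \<le> 2 + 2 * C * u" using lnR ln_le_minus_one[of 3] by (simp add: R_def)
  finally have ln\<rho>: "ln (1 / \<rho>) \<le> 2 + 2 * C * u" .
  have "(c_GW \<alpha> p u)\<^sup>2 * (u / (u + 1)) \<le> 2 * ln (sqrt (u + 1) / \<rho>)"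
    unfolding \<rho>_def by (rule c_GW_bound[OF \<alpha> p(1) p1 u0])
  also have "\<dots> = ln (u + 1) + 2 * ln (1 / \<rho>)"
    using u0 \<rho> by (simp add: ln_div ln_sqrt)
  also have "\<dots> \<le> u + 2 * (2 * u + 2 * C * u)"
    using ln\<rho> ln_add_one_self_le_self[of u] u by (simp add: add.commute)
  also have "\<dots> = (5 + 4 * C) * u" by (simp add: algebra_simps)
  finally have "(c_GW \<alpha> p u)\<^sup>2 * u / (u + 1) \<le> (5 + 4 * C) * u" by simp
  then have "(c_GW \<alpha> p u)\<^sup>2 * u \<le> (5 + 4 * C) * (u + 1) * u"
    using u0 by (simp add: pos_divide_le_eq mult_ac)
  then show ?thesis using u0 by simp
qed

text \<open>Because \<open>Q(c) \<le> \<rho> \<le> p / (1 - A)\<close> for the threshold \<open>c\<close>, sparsity pushes \<open>c\<close> to infinity.\<close>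

lemma c_GW_gt:
  fixes \<alpha> p u A :: real
  assumes \<alpha>: "0 < \<alpha>" "\<alpha> \<le> A" and A: "A < 1" and p: "0 < p" "p < 1" and u: "u > 0"
    and x: "p < (1 - A) * normal_tail x"
  shows "c_GW \<alpha> p u > x"
proof -
  let ?c = "c_GW \<alpha> p u"
  have \<alpha>1: "\<alpha> < 1" using \<alpha> A by simp
  have "\<alpha> * p > 0" using \<alpha> p by simp
  have "normal_tail ?c = \<alpha> * p / (1 - \<alpha> + \<alpha> * p) * normal_tail (?c / sqrt (u + 1))"
    by (rule c_GW_eq[OF \<alpha>(1) \<alpha>1 p u])
  also have "\<dots> \<le> p / (1 - A) * 1"
  proof (intro mult_mono frac_le)
    have "\<alpha> * p \<le> 1 * p" using \<alpha>1 p by (intro mult_right_mono) auto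
    then show "\<alpha> * p \<le> p" by simp
    show "1 - A \<le> 1 - \<alpha> + \<alpha> * p" using \<alpha> \<open>\<alpha> * p > 0\<close> by simp
    show "normal_tail (?c / sqrt (u + 1)) \<le> 1"
      by (simp add: normal_tail_def std_normal.cdf_nonneg)
  qed (use \<alpha> A p \<open>\<alpha> * p > 0\<close> in \<open>auto intro: less_imp_le\<close>)
  also have "\<dots> < normal_tail x" using x A by (simp add: pos_divide_less_eq mult.commute)
  finally show ?thesis by simp
qed

theorem theorem5p1:
  fixes M :: "nat \<Rightarrow> 'a measure"
    and \<nu> :: "nat \<Rightarrow> nat \<Rightarrow> 'a \<Rightarrow> nat"
    and X :: "nat \<Rightarrow> nat \<Rightarrow> 'a \<Rightarrow> real"
    and p \<sigma> \<tau> \<delta>\<^sub>0 \<delta>\<^sub>A u f \<delta> v \<alpha> r s :: "nat \<Rightarrow> real"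
    and C \<beta>\<^sub>p \<alpha>_inf :: real
  assumes params: "\<And>m. m \<ge> 1 \<Longrightarrow>
      0 < p m \<and> p m < 1 \<and> \<sigma> m > 0 \<and> \<tau> m > 0 \<and> \<delta>\<^sub>0 m > 0 \<and> \<delta>\<^sub>A m > 0"
    and model: "\<And>m. m \<ge> 1 \<Longrightarrow> two_groups_model (M m) m (p m) (\<sigma> m) (\<tau> m) (\<nu> m) (X m)"
    and u: "\<And>m. u m = (\<tau> m)\<^sup>2 / (\<sigma> m)\<^sup>2"
    and f: "\<And>m. f m = (1 - p m) / p m"
    and \<delta>: "\<And>m. \<delta> m = \<delta>\<^sub>0 m / \<delta>\<^sub>A m"
    and v: "\<And>m. v m = u m * (f m)\<^sup>2 * (\<delta> m)\<^sup>2"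
    and p_lim: "p \<longlonglongrightarrow> 0"
    and u_lim: "filterlim u at_top sequentially"
    and v_lim: "filterlim v at_top sequentially"
    and C_pos: "C > 0"
    and C_lim: "(\<lambda>m. ln (v m) / u m) \<longlonglongrightarrow> C"
    and \<beta>\<^sub>p: "\<beta>\<^sub>p > 1"
    and p_lower: "\<forall>\<^sub>F m in sequentially. p m > (ln (real m)) powr \<beta>\<^sub>p / real m"
    and \<alpha>_range: "\<And>m. m \<ge> 1 \<Longrightarrow> 0 < \<alpha> m \<and> \<alpha> m < 1"
    and \<alpha>_lim: "\<alpha> \<longlonglongrightarrow> \<alpha>_inf" "\<alpha>_inf < 1"
    and r: "\<And>m. r m = \<alpha> m / (1 - \<alpha> m)"
    and s: "\<And>m. ln (f m * \<delta> m * sqrt (u m)) / ln (f m / r m) = 1 + s m"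
    and s_lim: "s \<longlonglongrightarrow> 0"
    and s_cond: "filterlim (\<lambda>m. 2 * s m * ln (f m / r m) - ln (ln (f m / r m))) at_bot sequentially"
  shows "\<forall>\<epsilon>>0. \<forall>\<beta>\<^sub>1>0. \<forall>\<^sub>F m in sequentially.
    \<P>(\<omega> in M m. \<bar>c_BH (\<alpha> m) m (\<lambda>i. \<bar>X m i \<omega>\<bar> / \<sigma> m) - ereal (c_GW (\<alpha> m) (p m) (u m))\<bar> > ereal \<epsilon>)
      \<le> real m powr (- \<beta>\<^sub>1)"
proof (intro allI impI)
  fix \<epsilon> \<beta>\<^sub>1 :: real
  assume \<epsilon>: "\<epsilon> > 0" and \<beta>\<^sub>1: "\<beta>\<^sub>1 > 0"
  \<comment> \<open>The maximum with \<open>0\<close> makes \<open>A\<close> positive without appeal to \<open>\<alpha>_inf \<ge> 0\<close>.\<close>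
  define A where "A = (1 + max 0 \<alpha>_inf) / 2"
  have A: "0 < A" "A < 1" "\<alpha>_inf < A" using \<alpha>_lim(2) by (auto simp: A_def max_def)
  \<comment> \<open>\<open>B\<close> is an eventual upper bound for \<open>c_GW / sqrt (u + 1)\<close>.\<close>
  define B where "B = sqrt (5 + 4 * C)"
  define \<kappa> where "\<kappa> = normal_tail (B + \<epsilon>)"
  have \<kappa>: "\<kappa> > 0" by (simp add: \<kappa>_def)
  define \<theta> where "\<theta> = (1 + A) / 2"
  have \<theta>: "0 < \<theta>" "\<theta> < 1" using A by (auto simp: \<theta>_def)
  have \<gamma>: "\<theta> - 1 - ln \<theta> > 0"
    using ln_le_minus_one[OF \<theta>(1)] ln_eq_minus_one[OF \<theta>(1)] \<theta> by linarith
  define a where "a = min ((1 - ln 2) * \<kappa>) ((\<theta> - 1 - ln \<theta>) * 2 * \<kappa>)"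
  have a: "a > 0" using \<kappa> \<gamma> ln_2_less_1 by (simp add: a_def)
  \<comment> \<open>A threshold \<open>c > K\<close> satisfies \<open>exp (- ((c - \<epsilon>) * \<epsilon>)) \<le> (1 - A) * \<kappa>\<close>.\<close>
  define L where "L = ln ((1 - A) * \<kappa>)"
  define K where "K = \<epsilon> + \<bar>L\<bar> / \<epsilon>"
  have ev_\<alpha>: "\<forall>\<^sub>F m in sequentially. \<alpha> m < A" using \<alpha>_lim(1) A(3) by (rule order_tendstoD)
  have ev_p: "\<forall>\<^sub>F m in sequentially. p m < min (1 / 2) (min ((1 - A) / 2) ((1 - A) * normal_tail K))"
    using p_lim A by (intro order_tendstoD(2)[of p 0]) auto
  have ev_u: "\<forall>\<^sub>F m in sequentially. u m \<ge> 1" using u_lim by (simp add: filterlim_at_top)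
  have ev_v: "\<forall>\<^sub>F m in sequentially. ln (v m) / u m < 2 * C"
    using C_lim C_pos by (intro order_tendstoD) auto
  have ev_s: "\<forall>\<^sub>F m in sequentially. s m > - 1 / 2" using s_lim by (rule order_tendstoD) simp
  have ev_m: "\<forall>\<^sub>F m in sequentially. m \<ge> 1" by (rule eventually_ge_at_top)
  have ev_\<kappa>: "\<forall>\<^sub>F m in sequentially. 1 \<le> 2 * \<kappa> * (ln (real m) powr \<beta>\<^sub>p)"
    using \<kappa> \<beta>\<^sub>p by real_asymp
  have ev_fin: "\<forall>\<^sub>F m in sequentially.
      (1 + real m) * exp (- (a * ln (real m) powr \<beta>\<^sub>p)) \<le> real m powr (- \<beta>\<^sub>1)"
    using a \<beta>\<^sub>p \<beta>\<^sub>1 by real_asymp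
  show "\<forall>\<^sub>F m in sequentially.
    \<P>(\<omega> in M m. \<bar>c_BH (\<alpha> m) m (\<lambda>i. \<bar>X m i \<omega>\<bar> / \<sigma> m) - ereal (c_GW (\<alpha> m) (p m) (u m))\<bar> > ereal \<epsilon>)
      \<le> real m powr (- \<beta>\<^sub>1)"
    using ev_m ev_\<alpha> ev_p ev_u ev_v ev_s ev_\<kappa> ev_fin p_lower
  proof eventually_elim
    case (elim m)
    note m = \<open>m \<ge> 1\<close>
    have p: "0 < p m" "p m < 1" "p m < 1 / 2" "p m < (1 - A) / 2" "p m < (1 - A) * normal_tail K"
      and \<sigma>\<tau>: "\<sigma> m > 0" "\<tau> m > 0" and \<alpha>: "0 < \<alpha> m" "\<alpha> m < 1" "\<alpha> m \<le> A" and \<delta>0: "\<delta> m > 0"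
      using params[OF m] \<alpha>_range[OF m] elim by (auto simp: \<delta>)
    have u1: "u m \<ge> 1" by fact
    define c where "c = c_GW (\<alpha> m) (p m) (u m)"
    have fr: "f m / r m > 1"
    proof -
      have "1 < (1 - p m) * (1 - A) / p m"
      proof -
        have "p m < 1 / 2 * (1 - A)" using p by simp
        also have "\<dots> \<le> (1 - p m) * (1 - A)" using p A by (intro mult_right_mono) auto
        finally show ?thesis using p by (simp add: less_divide_eq)
      qed
      also have "\<dots> \<le> (1 - p m) * ((1 - \<alpha> m) / \<alpha> m) / p m"
      proof (intro divide_right_mono mult_left_mono)
        have "1 - A \<le> 1 - \<alpha> m" using \<alpha> by simp
        also have "\<dots> \<le> (1 - \<alpha> m) / \<alpha> m" using \<alpha> by (simp add: le_divide_eq mult_left_le)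
        finally show "1 - A \<le> (1 - \<alpha> m) / \<alpha> m" .
      qed (use p in auto)
      finally show ?thesis by (simp add: f r mult.commute)
    qed
    have "ln (f m / r m) \<le> 2 * C * u m"
    proof -
      have f0: "f m > 0" using p by (simp add: f)
      have "sqrt (v m) = f m * \<delta> m * sqrt (u m)"
        using f0 \<delta>0 by (simp add: v real_sqrt_mult)
      moreover have "v m > 0" using f0 \<delta>0 u1 by (simp add: v)
      ultimately have "ln (v m) / 2 = ln (f m * \<delta> m * sqrt (u m))"
        using ln_sqrt[of "v m"] by simp
      also have "\<dots> = (1 + s m) * ln (f m / r m)"
        using s[of m] ln_gt_zero[OF fr] by (subst (asm) nonzero_divide_eq_eq) linarith+
      also have "\<dots> \<ge> 1 / 2 * ln (f m / r m)"
        using elim fr by (intro mult_right_mono) auto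
      finally have "ln (f m / r m) \<le> ln (v m)" by simp
      also have "\<dots> \<le> 2 * C * u m" using elim by (simp add: pos_divide_less_eq)
      finally show ?thesis .
    qed
    then have "c\<^sup>2 \<le> (5 + 4 * C) * (u m + 1)"
      unfolding c_def using \<alpha> p u1 fr by (intro c_GW_le_signal_scale) (auto simp: f r)
    then have "sqrt (c\<^sup>2) \<le> B * sqrt (u m + 1)"
      unfolding B_def real_sqrt_mult[symmetric] by (rule real_sqrt_le_mono)
    then have cB: "c / sqrt (u m + 1) \<le> B" using u1 by (simp add: divide_le_eq)
    have "\<epsilon> / sqrt (u m + 1) \<le> \<epsilon>" using u1 \<epsilon> by (simp add: divide_le_eq mult_le_cancel_left1)
    with cB have h\<kappa>: "\<kappa> \<le> normal_tail ((c + \<epsilon>) / sqrt (u m + 1))"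
      by (simp add: \<kappa>_def add_divide_distrib)
    have "c > K" unfolding c_def using \<alpha> A p u1 by (intro c_GW_gt) auto
    have "\<epsilon> \<le> K" using \<epsilon> by (simp add: K_def)
    have "\<bar>L\<bar> / \<epsilon> < c - \<epsilon>" using \<open>c > K\<close> by (simp add: K_def)
    then have "\<bar>L\<bar> < (c - \<epsilon>) * \<epsilon>" using \<epsilon> by (simp only: pos_divide_less_eq)
    then have "exp (- ((c - \<epsilon>) * \<epsilon>)) \<le> exp L" by simp
    also have "\<dots> = (1 - A) * \<kappa>" using A \<kappa> by (simp add: L_def)
    finally have h2: "exp (- ((c - \<epsilon>) * \<epsilon>)) \<le> (1 - A) * \<kappa>" .
    moreover have "exp (- (c * \<epsilon>)) \<le> exp (- ((c - \<epsilon>) * \<epsilon>))" using \<epsilon> by simp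
    ultimately have h1: "exp (- (c * \<epsilon>)) \<le> (1 - A) * \<kappa>" by linarith
    have mp: "ln (real m) powr \<beta>\<^sub>p \<le> real m * p m"
      using elim by (simp add: divide_less_eq mult.commute)
    then have "2 * \<kappa> * (ln (real m) powr \<beta>\<^sub>p) \<le> 2 * \<kappa> * (real m * p m)"
      using \<kappa> by (intro mult_left_mono) auto
    with elim have h3: "1 \<le> 2 * \<kappa> * (real m * p m)" by linarith
    have exp_le: "exp (- (b * (real m * p m))) \<le> exp (- (a * ln (real m) powr \<beta>\<^sub>p))" if "a \<le> b" for b
    proof -
      have "a * ln (real m) powr \<beta>\<^sub>p \<le> b * (real m * p m)"
        using that a mp by (intro mult_mono) auto
      then show ?thesis by simp
    qed
    have "\<P>(\<omega> in M m. \<bar>c_BH (\<alpha> m) m (\<lambda>i. \<bar>X m i \<omega>\<bar> / \<sigma> m) - ereal c\<bar> > ereal \<epsilon>)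
        \<le> exp (- ((1 - ln 2) * \<kappa> * (real m * p m)))
          + real m * exp (- ((\<theta> - 1 - ln \<theta>) * 2 * \<kappa> * (real m * p m)))"
      unfolding \<theta>_def c_def
      using \<alpha> A p \<epsilon> \<kappa> \<sigma>\<tau> \<open>c > K\<close> \<open>\<epsilon> \<le> K\<close> h\<kappa> h1 h2 h3 u
      by (intro BH_deviation_bound[OF model[OF m] m]) (auto simp: c_def)
    also have "\<dots> \<le> exp (- (a * ln (real m) powr \<beta>\<^sub>p)) + real m * exp (- (a * ln (real m) powr \<beta>\<^sub>p))"
      by (intro add_mono mult_left_mono exp_le) (auto simp: a_def)
    also have "\<dots> = (1 + real m) * exp (- (a * ln (real m) powr \<beta>\<^sub>p))"
      by (simp add: algebra_simps)
    also have "\<dots> \<le> real m powr (- \<beta>\<^sub>1)" by fact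
    finally show ?case by (simp add: c_def)
  qed
qed

end
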